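(* For every integer $n\ge 3$ the following hold. (i) If $n$ is even, then $eqdim(C_n)=\frac{n}{2}$ when $n\not\equiv 0 \pmod 4$, and $eqdim(C_n)=\frac{3n}{4}-1$ when $n\equiv 0\pmod 4$. (ii) If $n$ is odd, then $$\frac{n-1}{2}\le eqdim(C_n)\le n-r\left(\left\lceil\tfrac{n+1}{4}\right\rceil\right).$$
   Context: $C_n$ is the cycle of order $n$; $d(x,y)$ denotes the graph distance. A set $S\subseteq V(G)$ of vertices of a connected graph $G$ is a distance-equalizer set of $G$ if for every two distinct vertices $x,y\in V(G)\setminus S$ there is $w\in S$ with $d(x,w)=d(y,w)$. The equidistant dimension $eqdim(G)$ is the minimum cardinality of a distance-equalizer set of $G$. A set $T\subseteq[m]=\{1,\dots,m\}$ is 3-AP-free if $a+c\ne 2b$ for all distinct $a,b,c\in T$; $r(m)$ denotes the largest cardinality of a 3-AP-free subset of $[m]$. *)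

theory Defs
  imports
    "Graph_Theory.Graph_Theory"
    Complex_Main
begin

text \<open>
  Simple graphs are symmetric loop-free digraphs without parallel arcs. The vertex \<open>i\<close> of the cycle
  of order \<open>n\<close> is joined to \<open>i + 1\<close> and \<open>i - 1\<close> modulo \<open>n\<close>; this is meant for \<open>n \<ge> 3\<close>.
\<close>

definition cycle_graph :: "nat \<Rightarrow> nat pair_pre_digraph" where
  "cycle_graph n = \<lparr> pverts = {..<n},
     parcs = (\<Union>i\<in>{..<n}. {(i, (i + 1) mod n), ((i + 1) mod n, i)}) \<rparr>"

text \<open>The graph distance is the cost of a cheapest walk when every arc has cost 1.\<close>

definition gdist :: "('a, 'b) pre_digraph \<Rightarrow> 'a \<Rightarrow> 'a \<Rightarrow> ereal" where
  "gdist G u v = wf_digraph.\<mu> G (\<lambda>_. 1) u v"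

definition distance_equalizer_set :: "('a, 'b) pre_digraph \<Rightarrow> 'a set \<Rightarrow> bool" where
  "distance_equalizer_set G S \<longleftrightarrow> S \<subseteq> verts G \<and>
     (\<forall>x \<in> verts G - S. \<forall>y \<in> verts G - S. x \<noteq> y \<longrightarrow> (\<exists>w\<in>S. gdist G x w = gdist G y w))"

text \<open>Meant for finite connected \<open>G\<close>; the minimum exists because \<open>verts G\<close> itself qualifies.\<close>

definition eqdim :: "('a, 'b) pre_digraph \<Rightarrow> nat" where
  "eqdim G = (LEAST k. \<exists>S. distance_equalizer_set G S \<and> card S = k)"

definition three_AP_free :: "nat set \<Rightarrow> bool" where
  "three_AP_free T \<longleftrightarrow>
     (\<forall>a\<in>T. \<forall>b\<in>T. \<forall>c\<in>T. a \<noteq> b \<and> b \<noteq> c \<and> a \<noteq> c \<longrightarrow> a + c \<noteq> 2 * b)"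

definition max_three_AP_free :: "nat \<Rightarrow> nat" where
  "max_three_AP_free m = Max {card T | T. T \<subseteq> {1..m} \<and> three_AP_free T}"

lemma gdist_eq_INF_length:
  assumes "wf_digraph G"
  shows "gdist G u v = (INF p\<in>{p. pre_digraph.awalk G u p v}. ereal (real (length p)))"
proof -
  interpret wf_digraph G by fact
  have "awalk_cost (\<lambda>_. 1) p = real (length p)" for p :: "'b list"
    by (induction p) auto
  then show ?thesis
    unfolding gdist_def \<mu>_def by simp
qed

lemma pair_graph_cycle_graph:
  assumes "n \<ge> 3"
  shows "pair_graph (cycle_graph n)"
proof
  fix e assume e: "e \<in> parcs (cycle_graph n)"
  show "fst e \<in> pverts (cycle_graph n)" "snd e \<in> pverts (cycle_graph n)"
    using e assms by (auto simp: cycle_graph_def)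
  have "Suc i mod n \<noteq> i" if "i < n" for i
    using that assms by (cases "Suc i = n") auto
  then show "fst e \<noteq> snd e"
    using e by (fastforce simp: cycle_graph_def)
next
  show "finite (pverts (cycle_graph n))" "finite (parcs (cycle_graph n))"
    by (auto simp: cycle_graph_def)
  show "symmetric (with_proj (cycle_graph n))"
    by (auto simp: symmetric_def cycle_graph_def sym_def)
qed

lemma connected_cycle_graph:
  assumes "n \<ge> 3"
  shows "connected (with_proj (cycle_graph n))"
proof -
  interpret pair_graph "cycle_graph n"
    by (rule pair_graph_cycle_graph) fact
  have from0: "0 \<rightarrow>\<^sup>*\<^bsub>cycle_graph n\<^esub> i" if "i < n" for i
    using that
  proof (induction i)
    case 0
    then show ?case by (intro reachable_refl) (simp add: cycle_graph_def)
  next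
    case (Suc i)
    moreover from Suc.prems have "(i, Suc i) \<in> parcs (cycle_graph n)"
      by (auto simp: cycle_graph_def intro!: bexI[of _ i])
    ultimately show ?case by (meson reachable_adj_trans Suc_lessD with_proj_simps)
  qed
  have "u \<rightarrow>\<^sup>*\<^bsub>cycle_graph n\<^esub> v" if "u < n" "v < n" for u v
    using from0[OF that(1)] from0[OF that(2)] symmetric_reachable' reachable_trans by blast
  then have reach: "u \<rightarrow>\<^sup>*\<^bsub>mk_symmetric (cycle_graph n)\<^esub> v" if "u < n" "v < n" for u v
    using that reachable_mk_symmetric_eq[OF pair_sym_arcs] by simp
  show ?thesis
  proof (rule connectedI)
    show "pverts (cycle_graph n) \<noteq> {}"
      using assms by (auto simp: cycle_graph_def lessThan_empty_iff)
  qed (use reach in \<open>simp add: cycle_graph_def\<close>)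
qed

end

theory Submission
  imports Defs "HOL-Number_Theory.Cong"
begin

text \<open>
  In the cycle of order \<open>n\<close>, two distinct vertices \<open>x\<close>, \<open>y\<close> are equidistant from \<open>w\<close> exactly if the
  reflection at \<open>w\<close> exchanges them, that is, if \<open>x + y \<equiv> 2 * w\<close> modulo \<open>n\<close>
  (\<open>gdist_cycle_eq_iff\<close>). So a set is distance-equalizing if and only if any two distinct vertices
  of its complement \<open>U\<close> have a solution \<open>w\<close> of this congruence outside \<open>U\<close>
  (\<open>distance_equalizer_cycle_iff\<close>), and the task is to find the largest such \<open>U\<close>.

  For even \<open>n\<close>, vertices of different parity admit no \<open>w\<close>, so \<open>U\<close> lies in one parity class and has
  at most \<open>n / 2\<close> elements. If \<open>n \<equiv> 2\<close> modulo 4, the two solutions \<open>w\<close> and \<open>w + n / 2\<close> for vertices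
  of equal parity have opposite parities, so one of them is always outside the class and \<open>U\<close> can be
  the whole class. If \<open>n = 4 * k\<close>, the two solutions have the same parity and \<open>U\<close> must not contain
  both. If \<open>U\<close> contains no antipodal pair at all, it has at most \<open>k\<close> elements. If it contains an
  antipodal pair, the reflection at this pair moves every other element of \<open>U\<close> out of \<open>U\<close>, which
  allows only \<open>k - 1\<close> further elements in the class. The bound \<open>k + 1\<close> is attained by
  \<open>{0, 2, \<dots>, 2 * k}\<close>.

  For odd \<open>n\<close>, the solution \<open>w\<close> is unique, so \<open>U\<close> must be free of three-term progressions modulo
  \<open>n\<close>. The reflection at a point of \<open>U\<close> moves all other points of \<open>U\<close> out of \<open>U\<close>, which bounds \<open>U\<close>
  by \<open>(n + 1) / 2\<close>. Conversely, a 3-AP-free set of integers in an interval of about a quarter of the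
  cycle acquires no new progressions modulo \<open>n\<close>: for \<open>x + y\<close> odd, the midpoint lies on the far side
  of the cycle.
\<close>

section \<open>Equidistant vertices in a cycle\<close>

lemma arc_cycle_iff:
  assumes "n \<ge> 3"
  shows "(u, v) \<in> parcs (cycle_graph n) \<longleftrightarrow>
    u < n \<and> v < n \<and> ([int v = int u + 1] (mod int n) \<or> [int u = int v + 1] (mod int n))"
proof -
  have step: "b = (a + 1) mod n \<longleftrightarrow> [int b = int a + 1] (mod int n)" if "b < n" for a b
  proof -
    have "[int b = int a + 1] (mod int n) \<longleftrightarrow> [b = a + 1] (mod n)"
      using cong_int_iff[of b "a + 1" n] by (simp add: add.commute)
    then show ?thesis using that by (simp add: cong_def)
  qed
  have "(u, v) \<in> parcs (cycle_graph n) \<longleftrightarrow>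
      u < n \<and> v < n \<and> (v = (u + 1) mod n \<or> u = (v + 1) mod n)"
    using assms by (auto simp: cycle_graph_def)
  then show ?thesis using step by blast
qed

text \<open>
  Winding around the cycle is recorded by integer displacements, so that no closed formula for the
  distance is needed: a walk of length \<open>k\<close> realizes a displacement of absolute value at most \<open>k\<close>.
\<close>

lemma awalk_cycle_displacement:
  assumes n: "n \<ge> 3" and "pre_digraph.awalk (with_proj (cycle_graph n)) u p v"
  shows "\<exists>d. \<bar>d\<bar> \<le> int (length p) \<and> [int v = int u + d] (mod int n)"
proof -
  interpret pair_graph "cycle_graph n"
    by (rule pair_graph_cycle_graph) fact
  show ?thesis using assms(2)
  proof (induction p arbitrary: u)
    case Nil
    then show ?case by (auto simp: awalk_Nil_iff intro!: exI[of _ 0])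
  next
    case (Cons e p)
    obtain u' where e: "e = (u, u')" "(u, u') \<in> parcs (cycle_graph n)" and w: "awalk u' p v"
      using Cons.prems by (cases e) (auto simp: awalk_Cons_iff)
    obtain d where d: "\<bar>d\<bar> \<le> int (length p)" "[int v = int u' + d] (mod int n)"
      using Cons.IH[OF w] by blast
    from e(2) consider "[int u' = int u + 1] (mod int n)" | "[int u = int u' + 1] (mod int n)"
      using arc_cycle_iff[OF n] by blast
    then show ?case
    proof cases
      case 1
      have "[int v = int u + (d + 1)] (mod int n)"
        using cong_trans[OF d(2) cong_add[OF 1 cong_refl[of d]]] by (simp add: algebra_simps)
      with d(1) show ?thesis by (intro exI[of _ "d + 1"]) auto
    next
      case 2
      have "[int u' = int u + (-1)] (mod int n)"
        using cong_sym[OF cong_diff[OF 2 cong_refl[of 1]]] by simp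
      from cong_trans[OF d(2) cong_add[OF this cong_refl[of d]]]
      have "[int v = int u + (d - 1)] (mod int n)" by (simp add: algebra_simps)
      with d(1) show ?thesis by (intro exI[of _ "d - 1"]) auto
    qed
  qed
qed

lemma awalk_cycle_of_displacement:
  assumes n: "n \<ge> 3" and "u < n" "v < n" "\<bar>d\<bar> = int k" "[int v = int u + d] (mod int n)"
  shows "\<exists>p. pre_digraph.awalk (with_proj (cycle_graph n)) u p v \<and> length p = k"
proof -
  interpret pair_graph "cycle_graph n"
    by (rule pair_graph_cycle_graph) fact
  show ?thesis using assms(2-)
  proof (induction k arbitrary: u d)
    case 0
    then have "u = v" by (simp add: cong_int_iff cong_def)
    moreover have "v \<in> pverts (cycle_graph n)" using 0 by (simp add: cycle_graph_def)
    ultimately show ?case by (auto simp: awalk_Nil_iff intro!: exI[of _ "[]"])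
  next
    case (Suc k)
    define s where "s = sgn d"
    have s: "s = 1 \<or> s = -1" and ds: "\<bar>d - s\<bar> = int k"
      using Suc.prems(3) by (auto simp: s_def sgn_if split: if_splits)
    define u' where "u' = nat ((int u + s) mod int n)"
    have u': "int u' = (int u + s) mod int n" "u' < n"
      using n by (auto simp: u'_def nat_less_iff)
    have c: "[int u' = int u + s] (mod int n)" by (simp add: cong_def u'(1))
    have "[int u' + (d - s) = int u + d] (mod int n)"
      using cong_add[OF c cong_refl[of "d - s"]] by simp
    from cong_trans[OF Suc.prems(4) cong_sym[OF this]]
    have "[int v = int u' + (d - s)] (mod int n)" .
    from Suc.IH[OF u'(2) Suc.prems(2) ds this]
    obtain p where p: "awalk u' p v" "length p = k" by blast
    have "[int u' = int u + 1] (mod int n) \<or> [int u = int u' + 1] (mod int n)"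
      using s
    proof
      assume "s = -1"
      with cong_sym[OF cong_add[OF c cong_refl[of 1]]] show ?thesis by simp
    qed (use c in simp)
    then have "(u, u') \<in> parcs (cycle_graph n)"
      using arc_cycle_iff[OF n] Suc.prems(1) u'(2) by blast
    then have "awalk u ((u, u') # p) v"
      using p(1) by (simp add: awalk_Cons_iff)
    with p(2) show ?case by (intro exI[of _ "(u, u') # p"]) simp
  qed
qed

lemma gdist_cycle_eq_INF:
  assumes n: "n \<ge> 3" and uv: "u < n" "v < n"
  shows "gdist (with_proj (cycle_graph n)) u v =
    (INF k\<in>{nat \<bar>d\<bar> | d. [int v = int u + d] (mod int n)}. ereal (real k))"
proof -
  interpret pair_graph "cycle_graph n"
    by (rule pair_graph_cycle_graph) fact
  have "(INF p\<in>{p. awalk u p v}. ereal (real (length p))) =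
    (INF k\<in>{nat \<bar>d\<bar> | d. [int v = int u + d] (mod int n)}. ereal (real k))"
  proof (rule INF_eq)
    fix p assume "p \<in> {p. awalk u p v}"
    then obtain d where "\<bar>d\<bar> \<le> int (length p)" "[int v = int u + d] (mod int n)"
      using awalk_cycle_displacement[OF n, of u p v] by auto
    then show "\<exists>k\<in>{nat \<bar>d\<bar> | d. [int v = int u + d] (mod int n)}.
        ereal (real k) \<le> ereal (real (length p))"
      by (intro bexI[of _ "nat \<bar>d\<bar>"]) auto
  next
    fix k assume "k \<in> {nat \<bar>d\<bar> | d. [int v = int u + d] (mod int n)}"
    then obtain d where "\<bar>d\<bar> = int k" "[int v = int u + d] (mod int n)" by auto
    from awalk_cycle_of_displacement[OF n uv this]
    show "\<exists>p\<in>{p. awalk u p v}. ereal (real (length p)) \<le> ereal (real k)" by auto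
  qed
  then show ?thesis
    using gdist_eq_INF_length[of "with_proj (cycle_graph n)" u v] wf_digraph_axioms
    by simp
qed

lemma INF_ereal_nat_attained:
  fixes K :: "nat set"
  assumes "K \<noteq> {}"
  shows "\<exists>k\<in>K. (INF k\<in>K. ereal (real k)) = ereal (real k)"
proof -
  have "(LEAST k. k \<in> K) \<in> K" using assms by (meson LeastI ex_in_conv)
  moreover have "(INF k\<in>K. ereal (real k)) = ereal (real (LEAST k. k \<in> K))"
    by (rule antisym) (auto intro!: INF_lower INF_greatest Least_le calculation)
  ultimately show ?thesis by blast
qed

text \<open>
  Shortest displacements from \<open>x\<close> and from \<open>y\<close> to \<open>w\<close> have the same absolute value; equal signs would
  mean \<open>x = y\<close>, and opposite signs give the congruence. Conversely, the congruence says that negation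
  maps the displacements from \<open>x\<close> to those from \<open>y\<close>.
\<close>

lemma gdist_cycle_eq_iff:
  assumes n: "n \<ge> 3" and xy: "x < n" "y < n" "w < n" "x \<noteq> y"
  shows "gdist (with_proj (cycle_graph n)) x w = gdist (with_proj (cycle_graph n)) y w \<longleftrightarrow>
    [x + y = 2 * w] (mod n)"
proof -
  define D where "D u = {nat \<bar>d\<bar> | d. [int w = int u + d] (mod int n)}" for u
  have gd: "gdist (with_proj (cycle_graph n)) u w = (INF k\<in>D u. ereal (real k))" if "u < n" for u
    unfolding D_def by (rule gdist_cycle_eq_INF[OF n that xy(3)])
  have dvd: "[int w = int u + d] (mod int n) \<longleftrightarrow> int n dvd int w - int u - d" for u d
    by (simp add: cong_iff_dvd_diff algebra_simps)
  have cong: "[x + y = 2 * w] (mod n) \<longleftrightarrow> int n dvd int x + int y - 2 * int w"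
    using cong_int_iff[of "x + y" "2 * w" n] by (simp add: cong_iff_dvd_diff)
  show ?thesis
  proof
    assume eq: "gdist (with_proj (cycle_graph n)) x w = gdist (with_proj (cycle_graph n)) y w"
    have ne: "D u \<noteq> {}" for u
      unfolding D_def by (auto intro!: exI[of _ "int w - int u"])
    obtain k where k: "k \<in> D x" "k \<in> D y"
      using INF_ereal_nat_attained[OF ne[of x]] INF_ereal_nat_attained[OF ne[of y]]
        eq gd[OF xy(1)] gd[OF xy(2)] by auto
    from k obtain d e where d: "int n dvd int w - int x - d" and e: "int n dvd int w - int y - e"
      and "nat \<bar>d\<bar> = nat \<bar>e\<bar>" by (auto simp: D_def dvd)
    then consider "e = d" | "e = - d" by linarith
    then show "[x + y = 2 * w] (mod n)"
    proof cases
      case 1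
      then have "int n dvd int x - int y" using dvd_diff[OF e d] by simp
      then have "x = y"
        using xy by (metis cong_iff_dvd_diff cong_int_iff cong_less_modulus_unique_nat)
      with xy show ?thesis by simp
    next
      case 2
      then have "int n dvd 2 * int w - int x - int y" using dvd_add[OF e d] by (simp add: algebra_simps)
      then have "int n dvd - (2 * int w - int x - int y)" by (simp only: dvd_minus_iff)
      then show ?thesis unfolding cong by (simp add: algebra_simps)
    qed
  next
    assume "[x + y = 2 * w] (mod n)"
    then have c: "int n dvd int x + int y - 2 * int w" by (simp add: cong)
    have "int n dvd int w - int x - d \<longleftrightarrow> int n dvd int w - int y - (- d)" for d
    proof -
      have "int w - int y - (- d) = - (int w - int x - d) - (int x + int y - 2 * int w)" by simp
      then show ?thesis using c by (metis dvd_diff_left_iff dvd_minus_iff)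
    qed
    then have "D x = D y"
      unfolding D_def dvd by (auto; metis abs_minus_cancel minus_minus)
    then show "gdist (with_proj (cycle_graph n)) x w = gdist (with_proj (cycle_graph n)) y w"
      using gd xy by simp
  qed
qed

lemma distance_equalizer_cycle_iff:
  assumes "n \<ge> 3"
  shows "distance_equalizer_set (with_proj (cycle_graph n)) S \<longleftrightarrow> S \<subseteq> {..<n} \<and>
    (\<forall>x \<in> {..<n} - S. \<forall>y \<in> {..<n} - S. x \<noteq> y \<longrightarrow> (\<exists>w\<in>S. [x + y = 2 * w] (mod n)))"
proof -
  have "gdist (with_proj (cycle_graph n)) x w = gdist (with_proj (cycle_graph n)) y w \<longleftrightarrow>
      [x + y = 2 * w] (mod n)"
    if "S \<subseteq> {..<n}" "x \<in> {..<n} - S" "y \<in> {..<n} - S" "x \<noteq> y" "w \<in> S" for x y w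
    using gdist_cycle_eq_iff[OF assms, of x y w] that by auto
  moreover have "verts (with_proj (cycle_graph n)) = {..<n}" by (simp add: cycle_graph_def)
  ultimately show ?thesis unfolding distance_equalizer_set_def by (metis (no_types, lifting))
qed

lemma eqdim_le_card: "distance_equalizer_set G S \<Longrightarrow> eqdim G \<le> card S"
  unfolding eqdim_def by (rule Least_le) blast

lemma eqdim_attained:
  obtains S where "distance_equalizer_set G S" "card S = eqdim G"
proof -
  have "distance_equalizer_set G (verts G)" by (simp add: distance_equalizer_set_def)
  then have "\<exists>S. distance_equalizer_set G S \<and> card S = eqdim G"
    unfolding eqdim_def by (intro LeastI_ex[of "\<lambda>k. \<exists>S. distance_equalizer_set G S \<and> card S = k"]) blast
  then show thesis using that by blast
qed

text \<open>Bounds on \<open>eqdim\<close> are most naturally found for the complement \<open>U\<close> of an equalizer.\<close>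

lemma eqdim_cycle_le:
  assumes "n \<ge> 3" "U \<subseteq> {..<n}"
    and "\<And>x y. x \<in> U \<Longrightarrow> y \<in> U \<Longrightarrow> x < y \<Longrightarrow> \<exists>w. w < n \<and> w \<notin> U \<and> [x + y = 2 * w] (mod n)"
  shows "eqdim (with_proj (cycle_graph n)) \<le> n - card U"
proof -
  have UU: "{..<n} - ({..<n} - U) = U" using assms(2) by blast
  have "\<exists>w\<in>{..<n} - U. [x + y = 2 * w] (mod n)" if "x \<in> U" "y \<in> U" "x \<noteq> y" for x y
  proof (cases "x < y")
    case True
    then show ?thesis using assms(3)[OF that(1,2)] by auto
  next
    case False
    then show ?thesis using assms(3)[OF that(2,1)] that(3) by (auto simp: add.commute)
  qed
  then have "distance_equalizer_set (with_proj (cycle_graph n)) ({..<n} - U)"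
    by (subst distance_equalizer_cycle_iff[OF assms(1)]) (auto simp: UU)
  from eqdim_le_card[OF this] show ?thesis
    using assms(2) by (simp add: card_Diff_subset finite_subset)
qed

lemma eqdim_cycle_complement:
  assumes "n \<ge> 3"
  obtains U where "U \<subseteq> {..<n}" "eqdim (with_proj (cycle_graph n)) + card U = n"
    "\<And>x y. x \<in> U \<Longrightarrow> y \<in> U \<Longrightarrow> x \<noteq> y \<Longrightarrow> \<exists>w. w < n \<and> w \<notin> U \<and> [x + y = 2 * w] (mod n)"
proof -
  obtain S where S: "distance_equalizer_set (with_proj (cycle_graph n)) S"
    and c: "card S = eqdim (with_proj (cycle_graph n))"
    by (rule eqdim_attained)
  have sub: "S \<subseteq> {..<n}" and
    eq: "\<And>x y. x \<in> {..<n} - S \<Longrightarrow> y \<in> {..<n} - S \<Longrightarrow> x \<noteq> y \<Longrightarrow> \<exists>w\<in>S. [x + y = 2 * w] (mod n)"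
    using S unfolding distance_equalizer_cycle_iff[OF assms] by auto
  show thesis
  proof (rule that[of "{..<n} - S"])
    have "card ({..<n} - S) = n - card S" "card S \<le> n"
      using sub finite_subset[OF sub] card_mono[OF _ sub] by (simp_all add: card_Diff_subset)
    then show "eqdim (with_proj (cycle_graph n)) + card ({..<n} - S) = n" using c by simp
  qed (use sub eq in \<open>auto, blast\<close>)
qed

section \<open>Bounds on the complement of an equalizer\<close>

text \<open>
  Outside the fixed points of the involution, \<open>U\<close> and its image are disjoint sets of the same size.
\<close>

lemma card_le_of_involution:
  assumes "finite V" "U \<subseteq> V" "F \<subseteq> V"
    and inv: "\<And>x. x \<in> V - F \<Longrightarrow> f x \<in> V - F \<and> f (f x) = x"
    and out: "\<And>x. x \<in> U - F \<Longrightarrow> f x \<notin> U"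
  shows "2 * card U \<le> card V + card F"
proof -
  have fin: "finite U" "finite F" using assms finite_subset by auto
  have inj: "inj_on f (U - F)"
    using inv assms(2) by (intro inj_on_inverseI[of _ f]) auto
  have "card (U - F) + card (U - F) = card ((U - F) \<union> f ` (U - F))"
    using out fin inj by (subst card_Un_disjoint) (auto simp: card_image)
  also have "\<dots> \<le> card (V - F)"
    using inv assms(1,2) by (intro card_mono) auto
  also have "\<dots> = card V - card F"
    using assms(3) fin by (simp add: card_Diff_subset)
  finally have "2 * card (U - F) \<le> card V - card F" by simp
  moreover have "card F \<le> card V" using assms(1,3) by (rule card_mono)
  moreover have "card U \<le> card (U - F) + card F"
    using diff_card_le_card_Diff[OF fin(2), of U] by linarith
  ultimately show ?thesis by linarith
qed

definition reflect :: "nat \<Rightarrow> nat \<Rightarrow> nat \<Rightarrow> nat" where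
  "reflect n w x = (2 * w + (n - x)) mod n"

lemma reflect_less: "n > 0 \<Longrightarrow> reflect n w x < n"
  by (simp add: reflect_def)

lemma cong_reflect: "x < n \<Longrightarrow> [x + reflect n w x = 2 * w] (mod n)"
  by (simp add: reflect_def cong_def mod_simps)

lemma reflect_reflect:
  assumes "x < n"
  shows "reflect n w (reflect n w x) = x"
proof -
  let ?y = "reflect n w x"
  have y: "?y < n" using assms by (simp add: reflect_less)
  have "[?y + x = ?y + reflect n w ?y] (mod n)"
    using cong_trans[OF cong_reflect[OF assms] cong_sym[OF cong_reflect[OF y]]]
    by (simp add: add.commute)
  then have "[x = reflect n w ?y] (mod n)" by (simp add: cong_add_lcancel_nat)
  moreover have "reflect n w ?y < n" using assms by (simp add: reflect_less)
  ultimately show ?thesis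
    using assms cong_less_modulus_unique_nat by metis
qed

lemma reflect_fixed_cong: "x < n \<Longrightarrow> reflect n w x = x \<Longrightarrow> [2 * x = 2 * w] (mod n)"
  using cong_reflect[of x n w] by (simp add: mult_2)

lemma even_cong_iff:
  fixes a b n :: nat
  assumes "even n" "[a = b] (mod n)"
  shows "even a \<longleftrightarrow> even b"
  using assms by (meson cong_dvd_iff cong_dvd_modulus_nat)

lemma card_parity_class:
  assumes "even n"
  shows "card {x. x < n \<and> (even x \<longleftrightarrow> P)} = n div 2"
proof -
  obtain m where m: "n = 2 * m" using assms by (rule evenE)
  have "{x. x < n \<and> (even x \<longleftrightarrow> P)} = (\<lambda>i. 2 * i + (if P then 0 else 1)) ` {..<m}"
  proof (cases P)
    case True
    then show ?thesis by (auto simp: m elim!: evenE)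
  next
    case False
    then show ?thesis by (auto simp: m elim!: oddE)
  qed
  then show ?thesis by (simp add: card_image inj_on_def m)
qed

lemma complement_parity:
  assumes "even n" "U \<subseteq> {..<n}"
    and "\<And>x y. x \<in> U \<Longrightarrow> y \<in> U \<Longrightarrow> x \<noteq> y \<Longrightarrow> \<exists>w::nat. [x + y = 2 * w] (mod n)"
  obtains P where "U \<subseteq> {x. x < n \<and> (even x \<longleftrightarrow> P)}"
proof (cases "U = {}")
  case False
  then obtain a where a: "a \<in> U" by blast
  have "even x \<longleftrightarrow> even a" if x: "x \<in> U" for x
  proof (cases "x = a")
    case False
    then obtain w where "[x + a = 2 * w] (mod n)" using assms(3)[OF x a] by blast
    then have "even (x + a)" using even_cong_iff[OF assms(1), of "x + a" "2 * w"] by simp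
    then show ?thesis by auto
  qed simp
  with assms(2) show thesis by (intro that[of "even a"]) auto
qed (use that in auto)

text \<open>
  Suppose that \<open>w\<close> and \<open>w + 2 * k\<close> lie in \<open>U\<close>. They are the only fixed points of the reflection at
  \<open>w\<close>, and the only vertices equidistant from the two elements of an orbit of size 2. So no
  such orbit is contained in \<open>U\<close>. If there is no such \<open>w\<close>, the antipodal map takes the place of the reflection.
\<close>

lemma complement_card_le_mod4:
  assumes k: "k \<ge> 1" and n: "n = 4 * k" and U: "U \<subseteq> {..<n}"
    and eq: "\<And>x y. x \<in> U \<Longrightarrow> y \<in> U \<Longrightarrow> x \<noteq> y \<Longrightarrow> \<exists>w. w < n \<and> w \<notin> U \<and> [x + y = 2 * w] (mod n)"
  shows "card U \<le> k + 1"
proof -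
  have ev: "even n" using n by simp
  obtain P where P: "U \<subseteq> {x. x < n \<and> (even x \<longleftrightarrow> P)}"
    using complement_parity[OF ev U] eq by metis
  define V where "V = {x. x < n \<and> (even x \<longleftrightarrow> P)}"
  have V: "finite V" "U \<subseteq> V" "card V = 2 * k"
    using P card_parity_class[OF ev, of P] n by (auto simp: V_def)
  show ?thesis
  proof (cases "\<exists>w. w \<in> U \<and> w + 2 * k \<in> U")
    case True
    then obtain w where w: "w \<in> U" "w + 2 * k \<in> U" by blast
    have w_less: "w < 2 * k" using w(2) U n by auto
    let ?F = "{w, w + 2 * k}"
    have half: "x \<in> ?F" if "x < n" "[2 * x = 2 * w] (mod n)" for x
    proof -
      have "[2 * x = 2 * w] (mod 2 * (2 * k))" using that(2) n by simp
      then have "x mod (2 * k) = w"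
        using w_less by (simp only: cong_def mult_mod_right[symmetric]) simp
      moreover have "x div (2 * k) < 2"
        using that(1) n by (simp add: less_mult_imp_div_less)
      then have "x div (2 * k) = 0 \<or> x div (2 * k) = 1" by linarith
      ultimately show ?thesis
        using mult_div_mod_eq[of "2 * k" x] by auto
    qed
    have refl_notin: "reflect n w x \<notin> U" if x_mem: "x \<in> U - ?F" for x
    proof
      assume r: "reflect n w x \<in> U"
      have x: "x < n" using x_mem U by auto
      have "reflect n w x \<noteq> x" using half[OF x] reflect_fixed_cong[OF x] x_mem by auto
      then obtain w' where w': "w' < n" "w' \<notin> U" "[x + reflect n w x = 2 * w'] (mod n)"
        using eq[of x "reflect n w x"] x_mem r by auto
      then have "[2 * w' = 2 * w] (mod n)"
        using cong_trans[OF cong_sym cong_reflect[OF x]] by blast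
      with half[OF w'(1)] w w'(2) show False by auto
    qed
    have refl_V: "reflect n w x \<in> V - ?F \<and> reflect n w (reflect n w x) = x" if x: "x \<in> V - ?F" for x
    proof -
      have xn: "x < n" using x by (simp add: V_def)
      have "even (x + reflect n w x)"
        using even_cong_iff[OF ev cong_reflect[OF xn]] by simp
      then have "reflect n w x \<in> V"
        using x reflect_less[of n w x] by (auto simp: V_def)
      moreover have "reflect n w x \<noteq> f" if f: "f \<in> ?F" for f
      proof
        assume r: "reflect n w x = f"
        have "f + f = 2 * w \<or> f + f = 2 * w + n" using f n by auto
        then have "[f + f = 2 * w] (mod n)" by (auto simp: cong_def)
        moreover have "[x + f = 2 * w] (mod n)" using cong_reflect[OF xn, of w] r by simp
        ultimately have "[x + f = f + f] (mod n)" using cong_sym cong_trans by blast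
        then have "x = f"
          using xn f w U by (auto simp: cong_add_rcancel_nat cong_less_modulus_unique_nat)
        with f x show False by blast
      qed
      ultimately show ?thesis using reflect_reflect[OF xn] by blast
    qed
    have "2 * card U \<le> card V + card ?F"
      using V w refl_V refl_notin by (intro card_le_of_involution[where f = "reflect n w"]) auto
    then show ?thesis using V(3) k by simp
  next
    case False
    then have no_antipodal: "w + 2 * k \<notin> U" if "w \<in> U" for w using that by blast
    let ?f = "\<lambda>x. if x < 2 * k then x + 2 * k else x - 2 * k"
    have "2 * card U \<le> card V + card ({} :: nat set)"
    proof (rule card_le_of_involution[where f = ?f])
      show "?f x \<in> V - {} \<and> ?f (?f x) = x" if "x \<in> V - {}" for x
        using that n by (auto simp: V_def)
      show "?f x \<notin> U" if "x \<in> U - {}" for x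
        using that no_antipodal[of x] no_antipodal[of "x - 2 * k"] by auto
    qed (use V in auto)
    then show ?thesis using V(3) by simp
  qed
qed

text \<open>
  The reflection at a point \<open>w\<close> of \<open>U\<close> fixes only \<open>w\<close>, since 2 is invertible modulo \<open>n\<close>, and \<open>w\<close> is
  the only vertex equidistant from the two elements of any other orbit.
\<close>

lemma complement_card_le_odd:
  assumes n: "odd n" and U: "U \<subseteq> {..<n}"
    and eq: "\<And>x y. x \<in> U \<Longrightarrow> y \<in> U \<Longrightarrow> x \<noteq> y \<Longrightarrow> \<exists>w. w < n \<and> w \<notin> U \<and> [x + y = 2 * w] (mod n)"
  shows "2 * card U \<le> n + 1"
proof (cases "U = {}")
  case False
  then obtain w where w: "w \<in> U" by blast
  then have wn: "w < n" using U by auto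
  have half: "x = w" if "x < n" "[2 * x = 2 * w] (mod n)" for x
    using that wn n
    by (metis cong_less_modulus_unique_nat cong_mult_lcancel_nat coprime_left_2_iff_odd)
  have "2 * card U \<le> card {..<n} + card {w}"
  proof (rule card_le_of_involution[where f = "reflect n w"])
    show "reflect n w x \<in> {..<n} - {w} \<and> reflect n w (reflect n w x) = x"
      if x: "x \<in> {..<n} - {w}" for x
    proof -
      have xn: "x < n" using x by simp
      have "reflect n w x \<noteq> w"
      proof
        assume "reflect n w x = w"
        then have "[x + w = w + w] (mod n)" using cong_reflect[OF xn, of w] by (simp add: mult_2)
        then have "x = w" using xn wn by (auto simp: cong_add_rcancel_nat cong_less_modulus_unique_nat)
        with x show False by simp
      qed
      then show ?thesis using reflect_reflect[OF xn] reflect_less[of n w x] xn by simp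
    qed
    show "reflect n w x \<notin> U" if x: "x \<in> U - {w}" for x
    proof
      assume r: "reflect n w x \<in> U"
      have xn: "x < n" using x U by auto
      have "reflect n w x \<noteq> x" using half[OF xn] reflect_fixed_cong[OF xn] x by auto
      then obtain w' where w': "w' < n" "w' \<notin> U" "[x + reflect n w x = 2 * w'] (mod n)"
        using eq[of x "reflect n w x"] x r by auto
      then have "[2 * w' = 2 * w] (mod n)"
        using cong_trans[OF cong_sym cong_reflect[OF xn]] by blast
      with half[OF w'(1)] w w'(2) show False by auto
    qed
  qed (use U wn in auto)
  then show ?thesis by simp
qed simp

section \<open>The equidistant dimension of cycles\<close>

lemma eqdim_cycle_mod4_2:
  assumes n: "n \<ge> 3" "n mod 4 = 2"
  shows "2 * eqdim (with_proj (cycle_graph n)) = n"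
proof -
  obtain k where k: "n = 4 * k + 2" using n(2) by (metis mult_div_mod_eq)
  have ev: "even n" using k by simp
  have "eqdim (with_proj (cycle_graph n)) \<le> n - card {x. x < n \<and> (even x \<longleftrightarrow> True)}"
  proof (rule eqdim_cycle_le[OF n(1)])
    fix x y assume "x \<in> {x. x < n \<and> (even x \<longleftrightarrow> True)}" "y \<in> {x. x < n \<and> (even x \<longleftrightarrow> True)}"
    then obtain a b where ab: "x = 2 * a" "y = 2 * b" by (auto elim!: evenE)
    define c where "c = (if odd (a + b) then a + b else a + b + (2 * k + 1))"
    have "odd c" by (simp add: c_def)
    have "odd (c mod n)" using \<open>odd c\<close> ev by (simp add: dvd_mod_iff)
    moreover have "2 * c = x + y \<or> 2 * c = x + y + n"
      by (simp add: c_def ab k)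
    then have "[x + y = 2 * (c mod n)] (mod n)"
      by (auto simp: cong_def mod_mult_right_eq)
    ultimately show "\<exists>w. w < n \<and> w \<notin> {x. x < n \<and> (even x \<longleftrightarrow> True)} \<and> [x + y = 2 * w] (mod n)"
      using n(1) by (intro exI[of _ "c mod n"]) simp
  qed auto
  then have upper: "eqdim (with_proj (cycle_graph n)) \<le> n - n div 2"
    by (simp only: card_parity_class[OF ev])
  obtain U where U: "U \<subseteq> {..<n}" "eqdim (with_proj (cycle_graph n)) + card U = n"
    "\<And>x y. x \<in> U \<Longrightarrow> y \<in> U \<Longrightarrow> x \<noteq> y \<Longrightarrow> \<exists>w. w < n \<and> w \<notin> U \<and> [x + y = 2 * w] (mod n)"
    using eqdim_cycle_complement[OF n(1)] by blast
  obtain P where "U \<subseteq> {x. x < n \<and> (even x \<longleftrightarrow> P)}"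
    using complement_parity[OF ev U(1)] U(3) by metis
  then have "card U \<le> n div 2"
    using card_mono[of "{x. x < n \<and> (even x \<longleftrightarrow> P)}" U] card_parity_class[OF ev, of P] by simp
  with upper U(2) k show ?thesis by simp
qed

lemma eqdim_cycle_mod4_0:
  assumes k: "k \<ge> 1"
  shows "eqdim (with_proj (cycle_graph (4 * k))) = 3 * k - 1"
proof -
  let ?n = "4 * k" and ?E = "(*) 2 ` {..k}"
  have n: "?n \<ge> 3" using k by simp
  have "eqdim (with_proj (cycle_graph ?n)) \<le> ?n - card ?E"
  proof (rule eqdim_cycle_le[OF n])
    fix x y assume "x \<in> ?E" "y \<in> ?E" "x < y"
    then obtain a b where ab: "x = 2 * a" "y = 2 * b" "a < b" "b \<le> k" by auto
    \<comment> \<open>Of the two solutions, this one lies on the side of the cycle opposite to \<open>?E\<close>.\<close>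
    let ?w = "a + b + 2 * k"
    have "[x + y = 2 * ?w] (mod ?n)"
    proof -
      have "2 * ?w = x + y + ?n" using ab by simp
      then show ?thesis by (simp only: cong_def mod_add_self2)
    qed
    moreover have "?w < ?n" "?w \<notin> ?E" using ab by auto
    ultimately show "\<exists>w. w < ?n \<and> w \<notin> ?E \<and> [x + y = 2 * w] (mod ?n)" by blast
  qed (use k in auto)
  moreover have "card ?E = k + 1" by (simp add: card_image inj_on_def)
  ultimately have upper: "eqdim (with_proj (cycle_graph ?n)) \<le> 3 * k - 1" by simp
  obtain U where U: "U \<subseteq> {..<?n}" "eqdim (with_proj (cycle_graph ?n)) + card U = ?n"
    "\<And>x y. x \<in> U \<Longrightarrow> y \<in> U \<Longrightarrow> x \<noteq> y \<Longrightarrow> \<exists>w. w < ?n \<and> w \<notin> U \<and> [x + y = 2 * w] (mod ?n)"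
    using eqdim_cycle_complement[OF n] by blast
  have "card U \<le> k + 1"
    by (rule complement_card_le_mod4[OF k refl U(1,3)])
  with upper U(2) k show ?thesis by linarith
qed

lemma eqdim_cycle_odd_ge:
  assumes "n \<ge> 3" "odd n"
  shows "n \<le> 2 * eqdim (with_proj (cycle_graph n)) + 1"
proof -
  obtain U where U: "U \<subseteq> {..<n}" "eqdim (with_proj (cycle_graph n)) + card U = n"
    "\<And>x y. x \<in> U \<Longrightarrow> y \<in> U \<Longrightarrow> x \<noteq> y \<Longrightarrow> \<exists>w. w < n \<and> w \<notin> U \<and> [x + y = 2 * w] (mod n)"
    using eqdim_cycle_complement[OF assms(1)] by blast
  from complement_card_le_odd[OF assms(2) U(1,3)] U(2) show ?thesis by linarith
qed

lemma eqdim_cycle_odd_le_AP_free: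
  assumes n: "n \<ge> 3" "odd n" and T: "T \<subseteq> {1..n div 4 + 1}" "three_AP_free T"
  shows "eqdim (with_proj (cycle_graph n)) \<le> n - card T"
proof (rule eqdim_cycle_le[OF n(1)])
  have "n div 4 + 1 < n" using n(1) by linarith
  with T(1) show "T \<subseteq> {..<n}" by auto
  fix x y assume xy: "x \<in> T" "y \<in> T" "x < y"
  then have le: "1 \<le> x" "y \<le> n div 4 + 1" using T(1) by auto
  show "\<exists>w. w < n \<and> w \<notin> T \<and> [x + y = 2 * w] (mod n)"
  proof (cases "even (x + y)")
    case True
    then obtain w where w: "x + y = 2 * w" by (rule evenE)
    have "w \<notin> T"
      using T(2) xy w unfolding three_AP_free_def by fastforce
    moreover have "w < n" using w le xy(3) n(1) by linarith
    ultimately show ?thesis using w by (intro exI[of _ w]) simp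
  next
    case False
    \<comment> \<open>Adding \<open>n\<close> turns to the other arc between \<open>x\<close> and \<open>y\<close>, whose midpoint is beyond \<open>T\<close>.\<close>
    with n(2) have "even (x + y + n)" by simp
    then obtain w where w: "x + y + n = 2 * w" by (rule evenE)
    have "w > n div 4 + 1" using w le xy(3) by linarith
    then have "w \<notin> T" using T(1) by auto
    moreover have "w < n" using w le xy(3) n(1) by linarith
    moreover have "[x + y = 2 * w] (mod n)" by (simp only: cong_def w[symmetric] mod_add_self2)
    ultimately show ?thesis by blast
  qed
qed

lemma max_three_AP_free_attained:
  obtains T where "T \<subseteq> {1..m}" "three_AP_free T" "card T = max_three_AP_free m"
proof -
  let ?C = "{card T | T. T \<subseteq> {1..m} \<and> three_AP_free T}"
  have "?C \<subseteq> card ` Pow {1..m}" by auto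
  then have "finite ?C" by (rule finite_subset) simp
  moreover have "card ({} :: nat set) \<in> ?C"
    by (auto simp: three_AP_free_def intro!: exI[of _ "{}"])
  ultimately have "Max ?C \<in> ?C" by (intro Max_in) auto
  then show thesis using that by (auto simp: max_three_AP_free_def)
qed

lemma ceiling_quarter_odd:
  assumes "odd n"
  shows "nat \<lceil>(real n + 1) / 4\<rceil> = n div 4 + 1"
proof -
  have "n = 4 * (n div 4) + 1 \<or> n = 4 * (n div 4) + 3" using assms by presburger
  then have "real n = 4 * real (n div 4) + 1 \<or> real n = 4 * real (n div 4) + 3" by linarith
  then have "\<lceil>(real n + 1) / 4\<rceil> = int (n div 4) + 1" by (auto intro!: ceiling_unique)
  then show ?thesis by simp
qed

theorem theorem15:
  fixes n :: nat
  assumes "n \<ge> 3"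
  shows "(even n \<longrightarrow>
            (n mod 4 \<noteq> 0 \<longrightarrow> real (eqdim (with_proj (cycle_graph n))) = real n / 2) \<and>
            (n mod 4 = 0 \<longrightarrow> real (eqdim (with_proj (cycle_graph n))) = 3 * real n / 4 - 1)) \<and>
         (odd n \<longrightarrow>
            (real n - 1) / 2 \<le> real (eqdim (with_proj (cycle_graph n))) \<and>
            real (eqdim (with_proj (cycle_graph n)))
              \<le> real n - real (max_three_AP_free (nat \<lceil>(real n + 1) / 4\<rceil>)))"
proof (intro conjI impI)
  assume "even n" "n mod 4 \<noteq> 0"
  then have "n mod 4 = 2" by presburger
  from eqdim_cycle_mod4_2[OF assms this]
  show "real (eqdim (with_proj (cycle_graph n))) = real n / 2" by linarith
next
  assume "n mod 4 = 0"
  then obtain k where k: "n = 4 * k" by auto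
  with assms have "k \<ge> 1" by simp
  from eqdim_cycle_mod4_0[OF this] this k
  show "real (eqdim (with_proj (cycle_graph n))) = 3 * real n / 4 - 1" by simp
next
  assume "odd n"
  from eqdim_cycle_odd_ge[OF assms this]
  have "real n \<le> real (2 * eqdim (with_proj (cycle_graph n)) + 1)" by (simp only: of_nat_le_iff)
  then show "(real n - 1) / 2 \<le> real (eqdim (with_proj (cycle_graph n)))" by simp
next
  assume odd: "odd n"
  obtain T where T: "T \<subseteq> {1..n div 4 + 1}" "three_AP_free T"
    "card T = max_three_AP_free (n div 4 + 1)"
    by (rule max_three_AP_free_attained)
  have "eqdim (with_proj (cycle_graph n)) \<le> n - card T"
    by (rule eqdim_cycle_odd_le_AP_free[OF assms odd T(1,2)])
  moreover have "card T \<le> n"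
    using card_mono[OF _ T(1)] assms by simp
  ultimately show "real (eqdim (with_proj (cycle_graph n)))
      \<le> real n - real (max_three_AP_free (nat \<lceil>(real n + 1) / 4\<rceil>))"
    using T(3) unfolding ceiling_quarter_odd[OF odd] by linarith
qed

end
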